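(* The translation $\mathrm{toAINF}$ from Polara into $\mathrm{AINF}$ produces terms with maximal fission. That is, for every type $t$ and every Polara term $e:\mathrm{Tm}\,\mathrm{VPar}\,t$, the translation returns a term $\mathrm{toAINF}\,e:\mathrm{AINF}\,t$ that is maximally fissioned: it is a finite flat sequence $$\mathsf{let}\ C_1[y_1=p_1];\ \dots;\ \mathsf{let}\ C_m[y_m=p_m];\ \mathsf{ret}\,v$$ in which $v$ is an atom, every $C_j$ is a scope context, and every $p_j$ is a single primitive operation without nested subexpressions (all its arguments, and the body of a $\mathsf{fun}$ or $\mathsf{for}$ primitive, are atoms), so that each assignment, regarded as its own separate loop, has a body consisting of only one operation.
   Context: **Types.** $t ::= \mathsf{fin}\,n \mid \mathsf{flt} \mid t\,\hat\times\,t \mid t\,\hat\to\,t \mid n\,\hat\Rightarrow\,t$ with $n\in\mathbb N$. Let $\mathrm{Ty}$ be the set of types. Here $\mathsf{fin}\,n$ is the type of naturals below $n$, $\mathsf{flt}$ the type of floating point numbers, and $n\,\hat\Rightarrow\,t$ the type of arrays of length $n$ with entries of type $t$. $\mathbb F$ is a fixed set of floating point literals. **Constants and their typings** (the arrow $\to$ below separates arguments from the result; it is not the type former $\hat\to$): $k:\mathsf{fin}\,m$ for naturals $k<m$; $f:\mathsf{flt}$ for $f\in\mathbb F$; $\hat+,\hat\cdot,\hat-,\hat/:\mathsf{flt}\to\mathsf{flt}\to\mathsf{flt}$; $\hat+:\mathsf{fin}\,n\to\mathsf{fin}\,m\to\mathsf{fin}(n+m-1)$; $\mathsf{app}:(t_1\hat\to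 t_2)\to t_1\to t_2$; $\mathsf{get}:(n\hat\Rightarrow t)\to\mathsf{fin}\,n\to t$; $\mathsf{pair}:t_1\to t_2\to(t_1\hat\times t_2)$; $\mathsf{fst}:(t_1\hat\times t_2)\to t_1$; $\mathsf{snd}:(t_1\hat\times t_2)\to t_2$; $\mathsf{sum}:(n\hat\Rightarrow\mathsf{flt})\to\mathsf{flt}$. **Polara terms** (intrinsically typed, parametric higher-order abstract syntax). For $\Gamma:\mathrm{Ty}\to\mathrm{Type}$, the family $\mathrm{Tm}\,\Gamma\,t$ is inductively generated by: - $\mathsf{var}\,x:\mathrm{Tm}\,\Gamma\,t$ for $x:\Gamma\,t$; - $c\,\overline{e}:\mathrm{Tm}\,\Gamma\,t'$ for a constant $c:t_1\to\dots\to t_k\to t'$ and $e_j:\mathrm{Tm}\,\Gamma\,t_j$; - $\mathsf{fun}\,e:\mathrm{Tm}\,\Gamma\,(t_1\hat\to t_2)$ for $e:\Gamma\,t_1\to\mathrm{Tm}\,\Gamma\,t_2$; - $\mathsf{for}\,e:\mathrm{Tm}\,\Gamma\,(n\hat\Rightarrow t)$ for $e:\Gamma(\mathsf{fin}\,n)\to\mathrm{Tm}\,\Gamma\,t$; - $\mathsf{ite}\,e_1\,e_2\,e_3:\mathrm{Tm}\,\Gamma\,t$ for $e_1:\mathrm{Tm}\,\Gamma(\mathsf{fin}\,2)$ and $e_2,e_3:\mathrm{Tm}\,\Gamma\,t$ (a condition counts as true iff nonzero); - $\mathsf{let}\,e_1;e_2:\mathrm{Tm}\,\Gamma\,t_2$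 for $e_1:\mathrm{Tm}\,\Gamma\,t_1$ and $e_2:\Gamma\,t_1\to\mathrm{Tm}\,\Gamma\,t_2$. **AINF (indexed administrative normal form)**, in intrinsically typed first-order syntax. For each type $t$, $\mathrm{Var}\,t=\{x_m^t: m\in\mathbb N\}$ and $\mathrm{Par}\,t=\{i_m^t:m\in\mathbb N\}$ are sets of names tagged by $t$ (variables, resp. indices), and $\mathrm{VPar}\,t=\mathrm{Var}\,t\sqcup\mathrm{Par}\,t$ (atoms). - Primitives $\mathrm{Prim}\,t$: an atom $v:\mathrm{VPar}\,t$; $c\,\overline v:\mathrm{Prim}\,t'$ for a constant $c:t_1\to\dots\to t_k\to t'$ and $v_j:\mathrm{VPar}\,t_j$; $\mathsf{fun}\,i.\,v:\mathrm{Prim}(t_1\hat\to t_2)$ for $i:\mathrm{Par}\,t_1$, $v:\mathrm{VPar}\,t_2$; $\mathsf{for}\,i.\,v:\mathrm{Prim}(n\hat\Rightarrow t)$ for $i:\mathrm{Par}(\mathsf{fin}\,n)$, $v:\mathrm{VPar}\,t$; $\mathsf{ite}\,v_1\,v_2\,v_3:\mathrm{Prim}\,t$ for $v_1:\mathrm{VPar}(\mathsf{fin}\,2)$, $v_2,v_3:\mathrm{VPar}\,t$. - Scope contexts $C$ (set $\mathrm{Env}$): finite lists of entries of the forms $\mathsf{fun}\,i{:}t$ ($i:\mathrm{Par}\,t$), $\mathsf{for}\,i{:}n$ ($i:\mathrm{Par}(\mathsf{fin}\,n)$), $\mathsf{if}\,v{\neq}0$, $\mathsf{if}\,v{=}0$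 ($v:\mathrm{VPar}(\mathsf{fin}\,2)$). Write $C[E]$ for $C$ extended by the innermost entry $E$. - $\mathrm{AINF}\,t$ is inductively generated by $\mathsf{ret}\,v$ for $v:\mathrm{VPar}\,t$, and $\mathsf{let}\ C[x=p];\,a$ for $C:\mathrm{Env}$, $x:\mathrm{Var}\,t_1$, $p:\mathrm{Prim}\,t_1$, $a:\mathrm{AINF}\,t$ ($t_1$ any type). The binding $\mathsf{let}\ C[x=p]$ is read as one loop nest/branch structure described by $C$ whose body computes $p$ and names it $x$. **Translation.** Put $\mathrm{Counter}(X)=\mathbb N\to X$ (the number is used only to generate fresh names; the particular naming scheme is immaterial). Smart binding: for $C:\mathrm{Env}$, $p:\mathrm{Prim}\,t_1$ and a continuation $k:\mathrm{VPar}\,t_1\to\mathrm{Counter}(\mathrm{AINF}\,t_2)$, define $(\!|p|\!)_C\,k:\mathrm{Counter}(\mathrm{AINF}\,t_2)$ by $((\!|v|\!)_C\,k)(m)=k\,v\,m$ if $p$ is an atom $v$, and $((\!|p|\!)_C\,k)(m)=\mathsf{let}\ C[x_m^{t_1}=p];\ k\,x_m^{t_1}\,(m+1)$ otherwise. For $C:\mathrm{Env}$, $e:\mathrm{Tm}\,\mathrm{VPar}\,t_1$ and $k:\mathrm{VPar}\,t_1\to\mathrm{Counter}(\mathrm{AINF}\,t_2)$, define $C\llbracket e\rrbracket\,k:\mathrm{Counter}(\mathrm{AINF}\,t_2)$ by recursion on $e$: - $C\llbracket\mathsf{var}\,v\rrbracket\,k=(\!|v|\!)_C\,k$; - $C\llbracket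 c\,e_1\cdots e_l\rrbracket\,k=C\llbracket e_1\rrbracket\,\lambda v_1.\ \cdots\ C\llbracket e_l\rrbracket\,\lambda v_l.\ (\!|c\,v_1\cdots v_l|\!)_C\,k$; - $(C\llbracket\mathsf{fun}\,e\rrbracket\,k)(m)=\big(C[\mathsf{fun}\,i{:}t]\llbracket e\,i\rrbracket\,\lambda v.\ (\!|\mathsf{fun}\,i.\,v|\!)_C\,k\big)(m+1)$, where $t$ is the argument type and $i=i_m^{t}$; - $(C\llbracket\mathsf{for}\,e\rrbracket\,k)(m)=\big(C[\mathsf{for}\,i{:}n]\llbracket e\,i\rrbracket\,\lambda v.\ (\!|\mathsf{for}\,i.\,v|\!)_C\,k\big)(m+1)$, where $n$ is the array length and $i=i_m^{\mathsf{fin}\,n}$; - $C\llbracket\mathsf{ite}\,e_1\,e_2\,e_3\rrbracket\,k=C\llbracket e_1\rrbracket\,\lambda v_1.\ C[\mathsf{if}\,v_1{\neq}0]\llbracket e_2\rrbracket\,\lambda v_2.\ C[\mathsf{if}\,v_1{=}0]\llbracket e_3\rrbracket\,\lambda v_3.\ (\!|\mathsf{ite}\,v_1\,v_2\,v_3|\!)_C\,k$; - $C\llbracket\mathsf{let}\,e_1;e_2\rrbracket\,k=C\llbracket e_1\rrbracket\,\lambda v_1.\ C\llbracket e_2\,v_1\rrbracket\,k$. Finally $\mathrm{toAINF}\,e=(C_0\llbracket e\rrbracket\,k_0)(0)$ with $C_0$ the empty scope context and $k_0\,v\,m=\mathsf{ret}\,v$. *)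

theory Defs
  imports Main
begin

datatype ty =
    Fin nat
  | Flt
  | Times ty ty
  | Arrow ty ty
  | Array nat ty

text \<open>
  Constants carry the parameters of their typing scheme, so that every constant has exactly one
  typing. The type variable \<open>'f\<close> is the set of floating point literals.
\<close>

datatype 'f cnst =
    CNat nat nat  \<comment> \<open>\<open>CNat k m\<close> is the literal \<open>k\<close> at type \<open>Fin m\<close>\<close>
  | CFlt 'f
  | FAdd | FMul | FSub | FDiv
  | NAdd nat nat
  | CApp ty ty
  | CGet nat ty
  | CPair ty ty
  | CFst ty ty
  | CSnd ty ty
  | CSum nat

fun cnst_valid :: "'f cnst \<Rightarrow> bool" where
  "cnst_valid (CNat k m) \<longleftrightarrow> k < m"
| "cnst_valid _ \<longleftrightarrow> True"

fun arg_tys :: "'f cnst \<Rightarrow> ty list" where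
  "arg_tys (CNat k m) = []"
| "arg_tys (CFlt f) = []"
| "arg_tys FAdd = [Flt, Flt]"
| "arg_tys FMul = [Flt, Flt]"
| "arg_tys FSub = [Flt, Flt]"
| "arg_tys FDiv = [Flt, Flt]"
| "arg_tys (NAdd n m) = [Fin n, Fin m]"
| "arg_tys (CApp t1 t2) = [Arrow t1 t2, t1]"
| "arg_tys (CGet n t) = [Array n t, Fin n]"
| "arg_tys (CPair t1 t2) = [t1, t2]"
| "arg_tys (CFst t1 t2) = [Times t1 t2]"
| "arg_tys (CSnd t1 t2) = [Times t1 t2]"
| "arg_tys (CSum n) = [Array n Flt]"

fun res_ty :: "'f cnst \<Rightarrow> ty" where
  "res_ty (CNat k m) = Fin m"
| "res_ty (CFlt f) = Flt"
| "res_ty FAdd = Flt"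
| "res_ty FMul = Flt"
| "res_ty FSub = Flt"
| "res_ty FDiv = Flt"
| "res_ty (NAdd n m) = Fin (n + m - 1)"
| "res_ty (CApp t1 t2) = t2"
| "res_ty (CGet n t) = t"
| "res_ty (CPair t1 t2) = Times t1 t2"
| "res_ty (CFst t1 t2) = t1"
| "res_ty (CSnd t1 t2) = t2"
| "res_ty (CSum n) = Flt"

text \<open>
  A family of types indexed by \<open>ty\<close> is rendered as its total space \<open>'v\<close> together with the
  projection \<open>\<Gamma> :: 'v \<Rightarrow> ty\<close>. Binders are functions on all of \<open>'v\<close>; the typing judgement only
  constrains them on the fibre over the type of the bound variable, and the translation never
  applies them outside this fibre. \<open>Lam\<close> and \<open>For\<close> record the argument type and the array
  length, which in the intrinsically typed syntax are given by the index.
\<close>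

datatype ('f, 'v) tm =
    Var 'v
  | Const "'f cnst" "('f, 'v) tm list"
  | Lam ty "'v \<Rightarrow> ('f, 'v) tm"
  | For nat "'v \<Rightarrow> ('f, 'v) tm"
  | Ite "('f, 'v) tm" "('f, 'v) tm" "('f, 'v) tm"
  | LetIn "('f, 'v) tm" "'v \<Rightarrow> ('f, 'v) tm"

text \<open>\<open>Tm \<Gamma> t e\<close> says that \<open>e\<close> belongs to the family of terms over \<open>\<Gamma>\<close> at index \<open>t\<close>.\<close>

inductive Tm :: "('v \<Rightarrow> ty) \<Rightarrow> ty \<Rightarrow> ('f, 'v) tm \<Rightarrow> bool" for \<Gamma> :: "'v \<Rightarrow> ty" where
  Tm_Var: "\<Gamma> x = t \<Longrightarrow> Tm \<Gamma> t (Var x)"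
| Tm_Const: "\<lbrakk>cnst_valid c; list_all2 (\<lambda>s e. Tm \<Gamma> s e) (arg_tys c) es\<rbrakk>
    \<Longrightarrow> Tm \<Gamma> (res_ty c) (Const c es)"
| Tm_Lam: "(\<And>x. \<Gamma> x = t1 \<Longrightarrow> Tm \<Gamma> t2 (e x)) \<Longrightarrow> Tm \<Gamma> (Arrow t1 t2) (Lam t1 e)"
| Tm_For: "(\<And>x. \<Gamma> x = Fin n \<Longrightarrow> Tm \<Gamma> t (e x)) \<Longrightarrow> Tm \<Gamma> (Array n t) (For n e)"
| Tm_Ite: "\<lbrakk>Tm \<Gamma> (Fin 2) e1; Tm \<Gamma> t e2; Tm \<Gamma> t e3\<rbrakk> \<Longrightarrow> Tm \<Gamma> t (Ite e1 e2 e3)"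
| Tm_LetIn: "\<lbrakk>Tm \<Gamma> t1 e1; \<And>x. \<Gamma> x = t1 \<Longrightarrow> Tm \<Gamma> t2 (e2 x)\<rbrakk> \<Longrightarrow> Tm \<Gamma> t2 (LetIn e1 e2)"

datatype var = X ty nat

datatype par = I ty nat

datatype vpar = V var | P par

fun var_ty :: "var \<Rightarrow> ty" where
  "var_ty (X t m) = t"

fun par_ty :: "par \<Rightarrow> ty" where
  "par_ty (I t m) = t"

fun vpar_ty :: "vpar \<Rightarrow> ty" where
  "vpar_ty (V x) = var_ty x"
| "vpar_ty (P i) = par_ty i"

datatype entry =
    EFun par ty
  | EFor par nat
  | EIfNZ vpar
  | EIfZ vpar

fun entry_ok :: "entry \<Rightarrow> bool" where
  "entry_ok (EFun i t) \<longleftrightarrow> par_ty i = t"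
| "entry_ok (EFor i n) \<longleftrightarrow> par_ty i = Fin n"
| "entry_ok (EIfNZ v) \<longleftrightarrow> vpar_ty v = Fin 2"
| "entry_ok (EIfZ v) \<longleftrightarrow> vpar_ty v = Fin 2"

text \<open>Scope contexts are lists with the innermost entry last.\<close>

type_synonym env = "entry list"

definition Env :: "env set" where
  "Env = {C. \<forall>E \<in> set C. entry_ok E}"

text \<open>
  Raw first-order terms, from which the primitives and AINF are carved out below. The raw syntax
  is deliberately more liberal than AINF: operands, bodies and right-hand sides of bindings may
  be arbitrary raw terms, including further bindings. That a term is flat, and that an operation
  has only atomic operands, are thus properties of a raw term and not enforced by its type.
\<close>

datatype 'f raw =
    RAtom vpar
  | RConst "'f cnst" "'f raw list"
  | RFun par "'f raw"
  | RFor par "'f raw"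
  | RIte "'f raw" "'f raw" "'f raw"
  | Ret vpar
  | RLet env var "'f raw" "'f raw"

inductive Prim :: "ty \<Rightarrow> 'f raw \<Rightarrow> bool" where
  Prim_Atom: "vpar_ty v = t \<Longrightarrow> Prim t (RAtom v)"
| Prim_Const: "\<lbrakk>cnst_valid c; map vpar_ty vs = arg_tys c\<rbrakk>
    \<Longrightarrow> Prim (res_ty c) (RConst c (map RAtom vs))"
| Prim_Fun: "\<lbrakk>par_ty i = t1; vpar_ty v = t2\<rbrakk> \<Longrightarrow> Prim (Arrow t1 t2) (RFun i (RAtom v))"
| Prim_For: "\<lbrakk>par_ty i = Fin n; vpar_ty v = t\<rbrakk> \<Longrightarrow> Prim (Array n t) (RFor i (RAtom v))"
| Prim_Ite: "\<lbrakk>vpar_ty v1 = Fin 2; vpar_ty v2 = t; vpar_ty v3 = t\<rbrakk>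
    \<Longrightarrow> Prim t (RIte (RAtom v1) (RAtom v2) (RAtom v3))"

inductive AINF :: "ty \<Rightarrow> 'f raw \<Rightarrow> bool" where
  AINF_Ret: "vpar_ty v = t \<Longrightarrow> AINF t (Ret v)"
| AINF_Let: "\<lbrakk>C \<in> Env; var_ty x = t1; Prim t1 p; AINF t a\<rbrakk> \<Longrightarrow> AINF t (RLet C x p a)"

type_synonym 'x counter = "nat \<Rightarrow> 'x"

text \<open>
  Smart binding; the explicit first argument is the type index of the primitive \<open>p\<close>, which names
  the fresh variable.
\<close>

definition smart ::
  "ty \<Rightarrow> env \<Rightarrow> 'f raw \<Rightarrow> (vpar \<Rightarrow> 'f raw counter) \<Rightarrow> 'f raw counter" where
  "smart t1 C p k = (\<lambda>m. case p of
      RAtom v \<Rightarrow> k v m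
    | _ \<Rightarrow> RLet C (X t1 m) p (k (V (X t1 m)) (m + 1)))"

primrec
  transl :: "('f, vpar) tm \<Rightarrow> env \<Rightarrow> (vpar \<Rightarrow> 'f raw counter) \<Rightarrow> 'f raw counter"
and
  transl_list :: "('f, vpar) tm list \<Rightarrow> env \<Rightarrow> (vpar list \<Rightarrow> 'f raw counter) \<Rightarrow> 'f raw counter"
where
  "transl (Var v) = (\<lambda>C k. smart (vpar_ty v) C (RAtom v) k)"
| "transl (Const c es) = (\<lambda>C k.
     transl_list es C (\<lambda>vs. smart (res_ty c) C (RConst c (map RAtom vs)) k))"
| "transl (Lam t e) = (\<lambda>C k m.
     transl (e (P (I t m))) (C @ [EFun (I t m) t])
       (\<lambda>v. smart (Arrow t (vpar_ty v)) C (RFun (I t m) (RAtom v)) k) (m + 1))"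
| "transl (For n e) = (\<lambda>C k m.
     transl (e (P (I (Fin n) m))) (C @ [EFor (I (Fin n) m) n])
       (\<lambda>v. smart (Array n (vpar_ty v)) C (RFor (I (Fin n) m) (RAtom v)) k) (m + 1))"
| "transl (Ite e1 e2 e3) = (\<lambda>C k.
     transl e1 C (\<lambda>v1.
     transl e2 (C @ [EIfNZ v1]) (\<lambda>v2.
     transl e3 (C @ [EIfZ v1]) (\<lambda>v3.
     smart (vpar_ty v2) C (RIte (RAtom v1) (RAtom v2) (RAtom v3)) k))))"
| "transl (LetIn e1 e2) = (\<lambda>C k. transl e1 C (\<lambda>v1. transl (e2 v1) C k))"
| "transl_list [] = (\<lambda>C k. k [])"
| "transl_list (e # es) = (\<lambda>C k. transl e C (\<lambda>v. transl_list es C (\<lambda>vs. k (v # vs))))"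

definition toAINF :: "('f, vpar) tm \<Rightarrow> 'f raw" where
  "toAINF e = transl e [] (\<lambda>v m. Ret v) 0"

fun atomic :: "'f raw \<Rightarrow> bool" where
  "atomic (RAtom v) \<longleftrightarrow> True"
| "atomic _ \<longleftrightarrow> False"

text \<open>
  Exactly one operation, with atoms as operands or body. A bare atom performs no operation.
\<close>

fun single_op :: "'f raw \<Rightarrow> bool" where
  "single_op (RAtom v) \<longleftrightarrow> False"
| "single_op (RConst c ps) \<longleftrightarrow> (\<forall>p \<in> set ps. atomic p)"
| "single_op (RFun i p) \<longleftrightarrow> atomic p"
| "single_op (RFor i p) \<longleftrightarrow> atomic p"
| "single_op (RIte p1 p2 p3) \<longleftrightarrow> atomic p1 \<and> atomic p2 \<and> atomic p3"
| "single_op (Ret v) \<longleftrightarrow> False"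
| "single_op (RLet C x p a) \<longleftrightarrow> False"

definition flat_seq :: "(env \<times> var \<times> 'f raw) list \<Rightarrow> vpar \<Rightarrow> 'f raw" where
  "flat_seq bs v = foldr (\<lambda>(C, y, p) a. RLet C y p a) bs (Ret v)"

definition maximally_fissioned :: "'f raw \<Rightarrow> bool" where
  "maximally_fissioned a \<longleftrightarrow>
     (\<exists>bs v. a = flat_seq bs v \<and> (\<forall>(C, y, p) \<in> set bs. C \<in> Env \<and> single_op p))"

end

theory Submission imports Defs
begin

text \<open>
  The translation is in continuation-passing style, so the property ``well typed and maximally
  fissioned'' is carried through it as a postcondition: it holds of the output if it holds of every
  result of the continuation on an atom of the right type. Output is only ever emitted by smart
  binding, which prepends a single binding, and that binding is never for a bare atom.
\<close>

definition fissioned_AINF :: "ty \<Rightarrow> 'f raw \<Rightarrow> bool" where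
  "fissioned_AINF t a \<longleftrightarrow> AINF t a \<and> maximally_fissioned a"

text \<open>The counter ranges over all values because the one at which a continuation is entered
  depends on the subterm translated before it.\<close>

definition fissioning_cont :: "ty \<Rightarrow> ty \<Rightarrow> (vpar \<Rightarrow> 'f raw counter) \<Rightarrow> bool" where
  "fissioning_cont s t k \<longleftrightarrow> (\<forall>v m. vpar_ty v = s \<longrightarrow> fissioned_AINF t (k v m))"

lemma Env_snoc: "C @ [E] \<in> Env \<longleftrightarrow> C \<in> Env \<and> entry_ok E"
  by (auto simp: Env_def)

text \<open>Raw syntax allows nesting; the rules of \<open>Prim\<close> force atomic operands. The
  bare atom is split off because \<open>single_op\<close> rejects it, matching the case distinction
  in \<open>smart\<close>.\<close>

lemma Prim_single_op: "Prim t p \<Longrightarrow> (\<exists>v. p = RAtom v \<and> vpar_ty v = t) \<or> single_op p"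
  by (induction rule: Prim.induct) auto

lemma maximally_fissioned_Ret: "maximally_fissioned (Ret v)"
  unfolding maximally_fissioned_def flat_seq_def by (rule exI[of _ "[]"]) simp

lemma maximally_fissioned_RLet:
  assumes "C \<in> Env" "single_op p" "maximally_fissioned a"
  shows "maximally_fissioned (RLet C x p a)"
proof -
  obtain bs v where "a = flat_seq bs v" "\<forall>(C, y, p) \<in> set bs. C \<in> Env \<and> single_op p"
    using assms(3) unfolding maximally_fissioned_def by blast
  then have "RLet C x p a = flat_seq ((C, x, p) # bs) v"
    "\<forall>(C, y, p) \<in> set ((C, x, p) # bs). C \<in> Env \<and> single_op p"
    using assms(1,2) by (auto simp: flat_seq_def)
  then show ?thesis unfolding maximally_fissioned_def by blast
qed

lemma fissioned_AINF_smart: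
  assumes p: "Prim s p" and C: "C \<in> Env" and k: "fissioning_cont s t k"
  shows "fissioned_AINF t (smart s C p k m)"
proof (cases "\<exists>v. p = RAtom v")
  case True
  with Prim_single_op[OF p] k show ?thesis
    by (auto simp: smart_def fissioning_cont_def)
next
  case False
  let ?x = "X s m"
  have "smart s C p k m = RLet C ?x p (k (V ?x) (m + 1))"
    using False by (cases p) (auto simp: smart_def)
  \<comment> \<open>\<open>X s m\<close> is tagged with \<open>s\<close>, so the assumption on
    \<open>k\<close> covers the fresh variable.\<close>
  moreover have "fissioned_AINF t (k (V ?x) (m + 1))"
    using k by (simp add: fissioning_cont_def)
  moreover have "single_op p"
    using Prim_single_op[OF p] False by blast
  ultimately show ?thesis
    using p C by (auto simp: fissioned_AINF_def intro: AINF_Let maximally_fissioned_RLet)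
qed

text \<open>The claim about each operand is a hypothesis, to be supplied by the induction on typing
  in the constant case. Each head atom is absorbed into the continuation for the tail, hence the
  induction over arbitrary \<open>k\<close>.\<close>

lemma fissioned_AINF_transl_list:
  assumes "list_all2 (\<lambda>s e. \<forall>C k m. C \<in> Env \<longrightarrow> fissioning_cont s t k
      \<longrightarrow> fissioned_AINF t (transl e C k m)) ts es"
    and "C \<in> Env"
    and "\<And>vs m. map vpar_ty vs = ts \<Longrightarrow> fissioned_AINF t (k vs m)"
  shows "fissioned_AINF t (transl_list es C k m)"
  using assms
proof (induction ts es arbitrary: k m rule: list_all2_induct)
  case Nil
  then show ?case by simp
next
  case (Cons s ts e es)
  have "fissioning_cont s t (\<lambda>v. transl_list es C (\<lambda>vs. k (v # vs)))"
    unfolding fissioning_cont_def by (auto intro!: Cons.IH Cons.prems)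
  with Cons.hyps Cons.prems(1) show ?case by simp
qed

lemma fissioned_AINF_transl:
  assumes "Tm vpar_ty s e" "C \<in> Env" "fissioning_cont s t k"
  shows "fissioned_AINF t (transl e C k m)"
  using assms
proof (induction arbitrary: C k m rule: Tm.induct)
  case (Tm_Var x s)
  then show ?case by (auto intro!: fissioned_AINF_smart Prim_Atom)
next
  case (Tm_Const c es)
  have "list_all2 (\<lambda>s e. \<forall>C k m. C \<in> Env \<longrightarrow> fissioning_cont s t k
      \<longrightarrow> fissioned_AINF t (transl e C k m)) (arg_tys c) es"
    using Tm_Const.IH by (rule list_all2_mono) blast
  then show ?case
    using Tm_Const.hyps Tm_Const.prems
    by (auto intro!: fissioned_AINF_transl_list fissioned_AINF_smart Prim_Const)
next
  case (Tm_Lam t1 t2 e)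
  \<comment> \<open>Unfolding only the instance at \<open>t2\<close> keeps the assumption on
    \<open>k\<close> in the form that the lemma on smart binding expects.\<close>
  have "fissioning_cont t2 t
      (\<lambda>v. smart (Arrow t1 (vpar_ty v)) C (RFun (I t1 m) (RAtom v)) k)"
    using Tm_Lam.prems by (auto simp: fissioning_cont_def[of t2] intro!: fissioned_AINF_smart Prim_Fun)
  then show ?case
    using Tm_Lam.prems by (auto simp: Env_snoc intro!: Tm_Lam.IH)
next
  case (Tm_For n s e)
  have "fissioning_cont s t
      (\<lambda>v. smart (Array n (vpar_ty v)) C (RFor (I (Fin n) m) (RAtom v)) k)"
    using Tm_For.prems by (auto simp: fissioning_cont_def[of s] intro!: fissioned_AINF_smart Prim_For)
  then show ?case
    using Tm_For.prems by (auto simp: Env_snoc intro!: Tm_For.IH)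
next
  case (Tm_Ite e1 s e2 e3)
  \<comment> \<open>The nested continuations are treated from the innermost outwards;
    \<open>vpar_ty v1 = Fin 2\<close> makes both branch entries admissible.\<close>
  have smart: "fissioned_AINF t
      (smart (vpar_ty v2) C (RIte (RAtom v1) (RAtom v2) (RAtom v3)) k m)"
    if "vpar_ty v1 = Fin 2" "vpar_ty v2 = s" "vpar_ty v3 = s" for v1 v2 v3 m
    using that Tm_Ite.prems by (auto intro!: fissioned_AINF_smart Prim_Ite)
  have e3: "fissioned_AINF t (transl e3 (C @ [EIfZ v1])
      (\<lambda>v3. smart (vpar_ty v2) C (RIte (RAtom v1) (RAtom v2) (RAtom v3)) k) m)"
    if "vpar_ty v1 = Fin 2" "vpar_ty v2 = s" for v1 v2 m
    using that Tm_Ite.prems(1) smart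
    by (intro Tm_Ite.IH) (simp_all add: Env_snoc fissioning_cont_def)
  have e2: "fissioned_AINF t (transl e2 (C @ [EIfNZ v1]) (\<lambda>v2. transl e3 (C @ [EIfZ v1])
      (\<lambda>v3. smart (vpar_ty v2) C (RIte (RAtom v1) (RAtom v2) (RAtom v3)) k)) m)"
    if "vpar_ty v1 = Fin 2" for v1 m
    using that Tm_Ite.prems(1) e3
    by (intro Tm_Ite.IH) (simp_all add: Env_snoc fissioning_cont_def)
  show ?case
    using Tm_Ite.prems(1) e2 by (auto simp: fissioning_cont_def intro!: Tm_Ite.IH(1))
next
  case (Tm_LetIn t1 e1 t2 e2)
  \<comment> \<open>A let emits no binding of its own: the atom obtained for \<open>e1\<close> is
    passed straight to \<open>e2\<close>.\<close>
  have "fissioning_cont t1 t (\<lambda>v. transl (e2 v) C k)"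
    using Tm_LetIn.IH(2) Tm_LetIn.prems by (simp add: fissioning_cont_def[of t1])
  then show ?case
    using Tm_LetIn.prems(1) by (simp add: Tm_LetIn.IH(1))
qed

theorem theorem3:
  fixes e :: "('f, vpar) tm" and t :: ty
  assumes "Tm vpar_ty t e"
  shows "AINF t (toAINF e) \<and> maximally_fissioned (toAINF e)"
proof -
  \<comment> \<open>The initial continuation ends the sequence, with the empty list of bindings as
    witness.\<close>
  have "fissioning_cont t t (\<lambda>v m. Ret v)"
    by (simp add: fissioning_cont_def fissioned_AINF_def AINF_Ret maximally_fissioned_Ret)
  moreover have "[] \<in> Env"
    by (simp add: Env_def)
  ultimately have "fissioned_AINF t (toAINF e)"
    unfolding toAINF_def using assms by (intro fissioned_AINF_transl)
  then show ?thesis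
    by (simp add: fissioned_AINF_def)
qed

end
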